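(* Let $G$ be a weakly modular graph. Then every BFS order of the vertices of $G$ is a distance-preserving ordering.
   Context: Graphs are simple, undirected, connected, possibly infinite; $d$ is graph distance, $N(x)$ the set of neighbors of $x$. Weakly modular: for every vertex $u$, (TC) for $v,w$ with $1=d(v,w)<d(u,v)=d(u,w)$ there is a common neighbor $x$ of $v,w$ with $d(u,x)=d(u,v)-1$, and (QC) for $v,w,z$ with $d(v,z)=d(w,z)=1$, $2=d(v,w)\le d(u,v)=d(u,w)=d(u,z)-1$ there is a common neighbor $x$ of $v,w$ with $d(u,x)=d(u,v)-1$. A well-order $\preceq$ on $V(G)$ is a BFS order if there is a family $\{A_x: x\in V(G)\}$ of subsets of $V(G)$ such that for every $x$: (S1) $x\in A_x$; (S2) if $x\preceq y$ then $A_x$ is an initial segment of $A_y$; (S3) $A_x=A_{(x)}\cup N(x)$, where $A_{(x)}=\{x\}$ if $x$ is the least element and $A_{(x)}=\bigcup_{y\prec x}A_y$ otherwise. A well-order $\prec$ is distance-preserving if for every vertex $v$ the subgraph of $G$ induced by $\{u: u\preceq v\}$ is an isometric subgraph of $G$. *)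

theory Defs
  imports Main "HOL-Library.Extended_Nat"
begin

definition simple_graph :: "'a set \<Rightarrow> ('a \<Rightarrow> 'a \<Rightarrow> bool) \<Rightarrow> bool" where
  "simple_graph V E \<longleftrightarrow> (\<forall>x y. E x y \<longrightarrow> x \<in> V \<and> y \<in> V \<and> x \<noteq> y \<and> E y x)"

definition walk_in :: "('a \<Rightarrow> 'a \<Rightarrow> bool) \<Rightarrow> 'a set \<Rightarrow> 'a list \<Rightarrow> bool" where
  "walk_in E S xs \<longleftrightarrow> xs \<noteq> [] \<and> set xs \<subseteq> S \<and> (\<forall>i. Suc i < length xs \<longrightarrow> E (xs ! i) (xs ! Suc i))"

text \<open>Distance in the subgraph induced by S (infinity if not connected within S).\<close>
definition gdist :: "('a \<Rightarrow> 'a \<Rightarrow> bool) \<Rightarrow> 'a set \<Rightarrow> 'a \<Rightarrow> 'a \<Rightarrow> enat" where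
  "gdist E S u v = (INF xs \<in> {xs. walk_in E S xs \<and> hd xs = u \<and> last xs = v}. enat (length xs - 1))"

definition connected_graph :: "'a set \<Rightarrow> ('a \<Rightarrow> 'a \<Rightarrow> bool) \<Rightarrow> bool" where
  "connected_graph V E \<longleftrightarrow> (\<forall>u\<in>V. \<forall>v\<in>V. \<exists>xs. walk_in E V xs \<and> hd xs = u \<and> last xs = v)"

definition weakly_modular :: "'a set \<Rightarrow> ('a \<Rightarrow> 'a \<Rightarrow> bool) \<Rightarrow> bool" where
  "weakly_modular V E \<longleftrightarrow> (let d = gdist E V in
     (\<forall>u\<in>V. \<forall>v\<in>V. \<forall>w\<in>V. d v w = 1 \<and> 1 < d u v \<and> d u v = d u w \<longrightarrow>
        (\<exists>x\<in>V. E x v \<and> E x w \<and> d u x = d u v - 1)) \<and>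
     (\<forall>u\<in>V. \<forall>v\<in>V. \<forall>w\<in>V. \<forall>z\<in>V.
        d v z = 1 \<and> d w z = 1 \<and> d v w = 2 \<and> 2 \<le> d u v \<and> d u v = d u w \<and> d u w = d u z - 1 \<longrightarrow>
        (\<exists>x\<in>V. E x v \<and> E x w \<and> d u x = d u v - 1)))"

definition nbhd :: "'a set \<Rightarrow> ('a \<Rightarrow> 'a \<Rightarrow> bool) \<Rightarrow> 'a \<Rightarrow> 'a set" where
  "nbhd V E x = {y \<in> V. E x y}"

definition initial_segment :: "('a \<times> 'a) set \<Rightarrow> 'a set \<Rightarrow> 'a set \<Rightarrow> bool" where
  "initial_segment R B C \<longleftrightarrow> B \<subseteq> C \<and> (\<forall>b\<in>B. \<forall>c\<in>C. (c, b) \<in> R \<longrightarrow> c \<in> B)"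

text \<open>R is a (reflexive) well-order on V; x precedes-or-equals y iff (x,y) in R.\<close>
definition bfs_order :: "'a set \<Rightarrow> ('a \<Rightarrow> 'a \<Rightarrow> bool) \<Rightarrow> ('a \<times> 'a) set \<Rightarrow> bool" where
  "bfs_order V E R \<longleftrightarrow> well_order_on V R \<and>
     (\<exists>A :: 'a \<Rightarrow> 'a set. \<forall>x\<in>V. A x \<subseteq> V \<and> x \<in> A x \<and>
        (\<forall>y\<in>V. (x, y) \<in> R \<longrightarrow> initial_segment R (A x) (A y)) \<and>
        A x = (if (\<forall>y\<in>V. (x, y) \<in> R) then {x}
               else (\<Union>y\<in>{y\<in>V. (y, x) \<in> R \<and> y \<noteq> x}. A y)) \<union> nbhd V E x)"

definition distance_preserving :: "'a set \<Rightarrow> ('a \<Rightarrow> 'a \<Rightarrow> bool) \<Rightarrow> ('a \<times> 'a) set \<Rightarrow> bool" where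
  "distance_preserving V E R \<longleftrightarrow> well_order_on V R \<and>
     (\<forall>v\<in>V. let S = {u\<in>V. (u, v) \<in> R} in
        \<forall>a\<in>S. \<forall>b\<in>S. gdist E S a b = gdist E V a b)"

end

theory Submission
  imports Defs
begin

text \<open>
  Write \<open>f x\<close> for the least neighbour of a vertex \<open>x\<close> other than the root. In a BFS order,
  \<open>f x\<close> precedes \<open>x\<close> and \<open>f\<close> is monotone; consequently any neighbour of a vertex preceding \<open>f c\<close>
  precedes \<open>c\<close>. The key fact, valid for any \<open>b\<close>, is that every \<open>p\<close> preceding \<open>c\<close> with
  \<open>d(b,p) \<ge> d(b,c) + 2\<close> has a neighbour that is closer to \<open>b\<close> and still precedes \<open>c\<close>. It is proved
  by passing from \<open>(p, c)\<close> to \<open>(f p, f c)\<close> and applying the triangle or quadrangle condition with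
  respect to \<open>b\<close>. For \<open>c = b\<close> it yields a geodesic from \<open>p\<close> to \<open>b\<close> that never passes a vertex
  after \<open>b\<close>.
\<close>

section \<open>Distances as lengths of shortest walks\<close>

lemma gdist_le_iff:
  "gdist E S u v \<le> enat n \<longleftrightarrow>
     (\<exists>xs. walk_in E S xs \<and> hd xs = u \<and> last xs = v \<and> length xs \<le> Suc n)"
proof
  let ?W = "{xs. walk_in E S xs \<and> hd xs = u \<and> last xs = v}"
  assume le: "gdist E S u v \<le> enat n"
  have "?W \<noteq> {}"
  proof
    \<comment> \<open>An infimum over no walks is infinite, which the finite bound excludes.\<close>
    assume "?W = {}"
    then have "gdist E S u v = \<infinity>"
      unfolding gdist_def by (simp only: image_empty Inf_enat_def) simp
    with le show False by simp
  qed
  \<comment> \<open>Extended naturals are well-ordered, so the infimum is attained: some walk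
    realises the distance.\<close>
  then have "gdist E S u v \<in> (\<lambda>xs. enat (length xs - 1)) ` ?W"
    unfolding gdist_def using wellorder_InfI[of _ "(\<lambda>xs. enat (length xs - 1)) ` ?W"] by blast
  with le show "\<exists>xs. walk_in E S xs \<and> hd xs = u \<and> last xs = v \<and> length xs \<le> Suc n"
    by auto
next
  assume "\<exists>xs. walk_in E S xs \<and> hd xs = u \<and> last xs = v \<and> length xs \<le> Suc n"
  then obtain xs where "walk_in E S xs" "hd xs = u" "last xs = v" and len: "length xs \<le> Suc n"
    by blast
  then have "gdist E S u v \<le> enat (length xs - 1)"
    unfolding gdist_def by (intro INF_lower) simp
  also have "\<dots> \<le> enat n" using len by simp
  finally show "gdist E S u v \<le> enat n" .
qed

lemma walk_in_singleton [simp]: "walk_in E S [x] \<longleftrightarrow> x \<in> S"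
  by (simp add: walk_in_def)

lemma walk_in_Cons_Cons [simp]:
  "walk_in E S (x # y # ys) \<longleftrightarrow> x \<in> S \<and> E x y \<and> walk_in E S (y # ys)"
  unfolding walk_in_def by (auto simp: nth_Cons split: nat.splits)

lemma gdist_self: "u \<in> S \<Longrightarrow> gdist E S u u = 0"
proof -
  assume "u \<in> S"
  then have "gdist E S u u \<le> enat 0"
    unfolding gdist_le_iff by (intro exI[of _ "[u]"]) simp
  then show ?thesis by (simp add: zero_enat_def[symmetric])
qed

lemma gdist_eq_0D: "gdist E S u v = 0 \<Longrightarrow> u = v"
proof -
  assume "gdist E S u v = 0"
  then have "gdist E S u v \<le> enat 0" by (simp add: zero_enat_def)
  then obtain xs where "walk_in E S xs" "hd xs = u" "last xs = v" "length xs \<le> Suc 0"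
    unfolding gdist_le_iff by blast
  then show ?thesis by (cases xs) (auto simp: walk_in_def)
qed

lemma gdist_edge_le:
  assumes "u \<in> S" "E u y" "gdist E S y v \<le> enat n"
  shows "gdist E S u v \<le> enat (Suc n)"
proof -
  obtain xs where xs: "walk_in E S xs" "hd xs = y" "last xs = v" "length xs \<le> Suc n"
    using assms(3) unfolding gdist_le_iff by blast
  then obtain ys where "xs = y # ys" by (cases xs) (auto simp: walk_in_def)
  with xs assms(1,2) show ?thesis
    unfolding gdist_le_iff by (intro exI[of _ "u # xs"]) auto
qed

text \<open>Take the second vertex of a shortest walk. The tail bounds its distance from above;
  anything smaller would, after prepending \<open>u\<close>, give a shorter walk from
  \<open>u\<close>.\<close>

lemma gdist_step:
  assumes "gdist E S u v = enat (Suc n)"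
  obtains y where "y \<in> S" "E u y" "gdist E S y v = enat n"
proof -
  obtain xs where xs: "walk_in E S xs" "hd xs = u" "last xs = v" "length xs \<le> Suc (Suc n)"
    using assms gdist_le_iff[of E S u v "Suc n"] by auto
  obtain ys where ys: "xs = u # ys" using xs by (cases xs) (auto simp: walk_in_def)
  have uS: "u \<in> S" using xs ys by (auto simp: walk_in_def)
  have "ys \<noteq> []"
  proof
    assume "ys = []"
    with xs ys have "u = v" by simp
    with gdist_self[OF uS, of E] assms show False by (simp add: zero_enat_def)
  qed
  then obtain y zs where zs: "ys = y # zs" by (cases ys) auto
  have y: "y \<in> S" "E u y" using xs ys zs by (auto simp: walk_in_def[of E S "y # zs"])
  have le: "gdist E S y v \<le> enat n"
    unfolding gdist_le_iff using xs ys zs by (intro exI[of _ "y # zs"]) auto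
  then obtain m where m: "gdist E S y v = enat m" "m \<le> n"
    by (cases "gdist E S y v") auto
  with gdist_edge_le[of u S E y v m, OF uS y(2)] assms have "m = n" by simp
  with y m that show thesis by simp
qed

lemma walk_in_rev:
  assumes "\<And>x y. E x y \<Longrightarrow> E y x" "walk_in E S xs"
  shows "walk_in E S (rev xs)"
  unfolding walk_in_def
proof (intro conjI allI impI)
  show "rev xs \<noteq> []" "set (rev xs) \<subseteq> S" using assms(2) by (auto simp: walk_in_def)
  fix i assume i: "Suc i < length (rev xs)"
  \<comment> \<open>Step \<open>i\<close> of the reversed walk is step
    \<open>length xs - 2 - i\<close> of \<open>xs\<close> traversed backwards.\<close>
  then have "E (xs ! (length xs - Suc (Suc i))) (xs ! Suc (length xs - Suc (Suc i)))"
    using assms(2) unfolding walk_in_def by auto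
  moreover have "Suc (length xs - Suc (Suc i)) = length xs - Suc i" using i by simp
  ultimately show "E (rev xs ! i) (rev xs ! Suc i)"
    using i by (auto simp: rev_nth intro: assms(1))
qed

lemma gdist_sym:
  assumes "\<And>x y. E x y \<Longrightarrow> E y x"
  shows "gdist E S u v = gdist E S v u"
proof -
  have "gdist E S v u \<le> gdist E S u v" for u v
  proof (cases "gdist E S u v")
    case (enat n)
    then obtain xs where xs: "walk_in E S xs" "hd xs = u" "last xs = v" "length xs \<le> Suc n"
      using gdist_le_iff[of E S u v n] by auto
    then have "gdist E S v u \<le> enat n"
      unfolding gdist_le_iff using walk_in_rev[OF assms xs(1)]
      by (intro exI[of _ "rev xs"]) (auto simp: hd_rev last_rev)
    with enat show ?thesis by simp
  qed simp
  then show ?thesis by (simp add: antisym)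
qed

lemma gdist_mono: "S \<subseteq> T \<Longrightarrow> gdist E T u v \<le> gdist E S u v"
  unfolding gdist_def by (intro INF_superset_mono) (auto simp: walk_in_def)

lemma gdist_finite:
  assumes "connected_graph V E" "u \<in> V" "v \<in> V"
  obtains n where "gdist E V u v = enat n"
proof -
  obtain xs where "walk_in E V xs" "hd xs = u" "last xs = v"
    using assms unfolding connected_graph_def by blast
  then have "gdist E V u v \<le> enat (length xs)"
    unfolding gdist_le_iff by (intro exI[of _ xs]) simp
  then show thesis using that by (cases "gdist E V u v") auto
qed

section \<open>Triangle and quadrangle conditions in terms of edges\<close>

lemma gdist_adjacent:
  assumes "simple_graph V E" "E u v"
  shows "gdist E V u v = 1"
proof -
  have V: "u \<in> V" "v \<in> V" "u \<noteq> v" using assms unfolding simple_graph_def by blast+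
  have "gdist E V v v \<le> enat 0" using gdist_self[OF V(2), of E] by simp
  from gdist_edge_le[of u V E v v 0, OF V(1) assms(2) this]
  obtain m where m: "gdist E V u v = enat m" "m \<le> 1"
    by (cases "gdist E V u v") auto
  moreover have "m \<noteq> 0" using m V(3) gdist_eq_0D[of E V u v] by (auto simp: zero_enat_def)
  ultimately show ?thesis by (simp add: one_enat_def le_Suc_eq)
qed

text \<open>Supplies the premise on the distance between the two near vertices in the quadrangle
  condition: the walk through \<open>z\<close> gives at most 2, while distinctness and non-adjacency
  exclude 0 and 1.\<close>

lemma gdist_common_neighbour:
  assumes "simple_graph V E" "E u z" "E z v" "u \<noteq> v" "\<not> E u v"
  shows "gdist E V u v = 2"
proof -
  have V: "u \<in> V" using assms unfolding simple_graph_def by blast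
  have "gdist E V z v \<le> enat 1" using gdist_adjacent[OF assms(1,3)] by (simp add: one_enat_def)
  from gdist_edge_le[of u V E z v 1, OF V assms(2) this]
  obtain m where m: "gdist E V u v = enat m" "m \<le> 2"
    by (cases "gdist E V u v") auto
  moreover have "m \<noteq> 0" using m assms(4) gdist_eq_0D[of E V u v] by (auto simp: zero_enat_def)
  moreover have "m \<noteq> 1"
  proof
    assume "m = 1"
    with m have "gdist E V u v = enat (Suc 0)" by simp
    then obtain y where "E u y" "gdist E V y v = enat 0" by (rule gdist_step)
    then show False using assms(5) gdist_eq_0D[of E V y v] by (simp add: zero_enat_def)
  qed
  ultimately have "m = 2" by linarith
  with m show ?thesis by (simp add: numeral_eq_enat)
qed

text \<open>Writing distances as \<open>enat (Suc n)\<close> replaces subtraction on extended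
  naturals by a predecessor; \<open>n \<ge> 1\<close> encodes the premise that the common distance
  exceeds 1.\<close>

lemma weakly_modular_triangle:
  assumes "simple_graph V E" "weakly_modular V E" "u \<in> V" "E v w"
    and "gdist E V u v = enat (Suc n)" "gdist E V u w = enat (Suc n)" "n \<ge> 1"
  obtains x where "x \<in> V" "E v x" "E w x" "gdist E V u x = enat n"
proof -
  have "v \<in> V" "w \<in> V" using assms(1,4) unfolding simple_graph_def by blast+
  moreover have "gdist E V v w = 1" by (rule gdist_adjacent[OF assms(1,4)])
  moreover have "1 < gdist E V u v" "gdist E V u v = gdist E V u w"
    using assms(5-) by (simp_all add: one_enat_def)
  ultimately obtain x where "x \<in> V" "E x v" "E x w" "gdist E V u x = gdist E V u v - 1"
    using assms(2,3) unfolding weakly_modular_def Let_def by blast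
  moreover from this have "gdist E V u x = enat n" using assms(5) by (simp add: one_enat_def)
  ultimately show thesis using that assms(1) unfolding simple_graph_def by blast
qed

lemma weakly_modular_quadrangle:
  assumes "simple_graph V E" "weakly_modular V E" "u \<in> V" "E v z" "E w z" "v \<noteq> w" "\<not> E v w"
    and "gdist E V u v = enat (Suc n)" "gdist E V u w = enat (Suc n)"
    and "gdist E V u z = enat (Suc (Suc n))" "n \<ge> 1"
  obtains x where "x \<in> V" "E v x" "E w x" "gdist E V u x = enat n"
proof -
  have "v \<in> V" "w \<in> V" "z \<in> V" "E z w" using assms(1,4,5) unfolding simple_graph_def by blast+
  moreover have "gdist E V v z = 1" "gdist E V w z = 1"
    using gdist_adjacent[OF assms(1)] assms(4,5) by auto
  moreover have "gdist E V v w = 2"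
    using gdist_common_neighbour[OF assms(1,4) \<open>E z w\<close> assms(6,7)] .
  moreover have "2 \<le> gdist E V u v" "gdist E V u v = gdist E V u w"
    "gdist E V u w = gdist E V u z - 1"
    using assms(8-) by (simp_all add: one_enat_def numeral_eq_enat)
  ultimately obtain x where "x \<in> V" "E x v" "E x w" "gdist E V u x = gdist E V u v - 1"
    using assms(2,3) unfolding weakly_modular_def Let_def by blast
  moreover from this have "gdist E V u x = enat n" using assms(8) by (simp add: one_enat_def)
  ultimately show thesis using that assms(1) unfolding simple_graph_def by blast
qed

section \<open>Well-orders and the parent map of a BFS order\<close>

lemma well_order_onD:
  assumes "well_order_on V R"
  shows "x \<in> V \<Longrightarrow> (x, x) \<in> R"
    and "(x, y) \<in> R \<Longrightarrow> (y, z) \<in> R \<Longrightarrow> (x, z) \<in> R"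
    and "(x, y) \<in> R \<Longrightarrow> (y, x) \<in> R \<Longrightarrow> x = y"
    and "x \<in> V \<Longrightarrow> y \<in> V \<Longrightarrow> (x, y) \<in> R \<or> (y, x) \<in> R"
proof -
  have "refl_on V R" "trans R" "antisym R" "total_on V R"
    using assms
    unfolding well_order_on_def linear_order_on_def partial_order_on_def preorder_on_def
    by auto
  then show "x \<in> V \<Longrightarrow> (x, x) \<in> R"
    and "(x, y) \<in> R \<Longrightarrow> (y, z) \<in> R \<Longrightarrow> (x, z) \<in> R"
    and "(x, y) \<in> R \<Longrightarrow> (y, x) \<in> R \<Longrightarrow> x = y"
    and "x \<in> V \<Longrightarrow> y \<in> V \<Longrightarrow> (x, y) \<in> R \<or> (y, x) \<in> R"
    by (metis refl_onD transD antisymD total_on_def)+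
qed

lemma well_order_on_least:
  assumes "well_order_on V R" "Q \<subseteq> V" "Q \<noteq> {}"
  shows "\<exists>m\<in>Q. \<forall>y\<in>Q. (m, y) \<in> R"
proof -
  have "wf (R - Id)" using assms(1) by (simp add: well_order_on_def)
  then obtain m where m: "m \<in> Q" "\<And>y. (y, m) \<in> R - Id \<Longrightarrow> y \<notin> Q"
    using assms(3) by (metis wfE_min')
  have "(m, y) \<in> R" if "y \<in> Q" for y
    using well_order_onD(1,4)[OF assms(1)] m that assms(2) by blast
  with m show ?thesis by blast
qed

text \<open>The parent \<open>f x\<close> arises as the least index \<open>p\<close> with
  \<open>x \<in> A p\<close>, the moment at which \<open>x\<close> is discovered. Its properties are
  claimed only away from the root \<open>r\<close>, which is discovered by itself.\<close>

lemma bfs_order_parent: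
  assumes "simple_graph V E" "bfs_order V E R" "V \<noteq> {}"
  obtains r f where "r \<in> V" "\<And>x. x \<in> V \<Longrightarrow> (r, x) \<in> R"
    and "\<And>x. x \<in> V \<Longrightarrow> x \<noteq> r \<Longrightarrow> f x \<in> V \<and> E x (f x) \<and> (f x, x) \<in> R"
    and "\<And>x w. x \<in> V \<Longrightarrow> x \<noteq> r \<Longrightarrow> E x w \<Longrightarrow> (f x, w) \<in> R"
    and "\<And>x y. x \<in> V \<Longrightarrow> x \<noteq> r \<Longrightarrow> y \<in> V \<Longrightarrow> y \<noteq> r \<Longrightarrow> (x, y) \<in> R \<Longrightarrow> (f x, f y) \<in> R"
proof -
  have wo: "well_order_on V R" using assms(2) by (simp add: bfs_order_def)
  note R = well_order_onD[OF wo]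
  obtain A where all: "\<forall>x\<in>V. A x \<subseteq> V \<and> x \<in> A x \<and>
      (\<forall>y\<in>V. (x, y) \<in> R \<longrightarrow> initial_segment R (A x) (A y)) \<and>
      A x = (if (\<forall>y\<in>V. (x, y) \<in> R) then {x}
             else (\<Union>y\<in>{y\<in>V. (y, x) \<in> R \<and> y \<noteq> x}. A y)) \<union> nbhd V E x"
    using assms(2) unfolding bfs_order_def by blast
  have A: "x \<in> A x"
    and seg: "y \<in> V \<Longrightarrow> (x, y) \<in> R \<Longrightarrow> initial_segment R (A x) (A y)"
    and rec: "A x = (if (\<forall>y\<in>V. (x, y) \<in> R) then {x}
             else (\<Union>y\<in>{y\<in>V. (y, x) \<in> R \<and> y \<noteq> x}. A y)) \<union> nbhd V E x"
    if "x \<in> V" for x y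
    using bspec[OF all that] by blast+
  have sym: "E x y \<Longrightarrow> x \<in> V \<and> y \<in> V \<and> E y x" for x y
    using assms(1) unfolding simple_graph_def by blast
  obtain r where r: "r \<in> V" "\<And>x. x \<in> V \<Longrightarrow> (r, x) \<in> R"
    using well_order_on_least[OF wo subset_refl assms(3)] by blast
  have "\<exists>p. p \<in> V \<and> x \<in> A p \<and> (\<forall>y\<in>V. x \<in> A y \<longrightarrow> (p, y) \<in> R)" if "x \<in> V" for x
  proof -
    have "{y \<in> V. x \<in> A y} \<noteq> {}" using A that by blast
    then have "\<exists>p\<in>{y \<in> V. x \<in> A y}. \<forall>y\<in>{y \<in> V. x \<in> A y}. (p, y) \<in> R"
      by (intro well_order_on_least[OF wo]) blast+
    then show ?thesis by blast
  qed
  then obtain f where f: "\<And>x. x \<in> V \<Longrightarrow> f x \<in> V" "\<And>x. x \<in> V \<Longrightarrow> x \<in> A (f x)"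
    "\<And>x y. x \<in> V \<Longrightarrow> y \<in> V \<Longrightarrow> x \<in> A y \<Longrightarrow> (f x, y) \<in> R"
    by metis
  show thesis
  proof (rule that[OF r, of f])
    fix x assume x: "x \<in> V" "x \<noteq> r"
    \<comment> \<open>By (S3), a vertex of \<open>A (f x)\<close> that is not a neighbour of
      \<open>f x\<close> is either the root itself or already in some earlier \<open>A y\<close>;
      the latter contradicts the minimality of \<open>f x\<close>.\<close>
    have "x \<in> nbhd V E (f x)"
    proof (rule ccontr)
      assume nb: "x \<notin> nbhd V E (f x)"
      show False
      proof (cases "\<forall>y\<in>V. (f x, y) \<in> R")
        case True
        then have "f x = r" using r f(1) x R(3) by blast
        moreover have "A (f x) = {f x} \<union> nbhd V E (f x)"
          using rec[OF f(1)[OF x(1)]] unfolding if_P[OF True] .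
        ultimately show False using nb x(2) f(2)[OF x(1)] by blast
      next
        case False
        have "A (f x) = (\<Union>y\<in>{y\<in>V. (y, f x) \<in> R \<and> y \<noteq> f x}. A y) \<union> nbhd V E (f x)"
          using rec[OF f(1)[OF x(1)]] unfolding if_not_P[OF False] .
        then obtain y where "y \<in> V" "(y, f x) \<in> R" "y \<noteq> f x" "x \<in> A y"
          using nb f(2)[OF x(1)] by blast
        then show False using f(3) x R(3) by blast
      qed
    qed
    then show "f x \<in> V \<and> E x (f x) \<and> (f x, x) \<in> R"
      using f x A sym unfolding nbhd_def by blast
  next
    fix x w assume "x \<in> V" "x \<noteq> r" "E x w"
    then have "w \<in> V" "x \<in> nbhd V E w" using sym unfolding nbhd_def by blast+
    then have "x \<in> A w" using rec[of w] by blast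
    then show "(f x, w) \<in> R" using f(3) \<open>x \<in> V\<close> \<open>w \<in> V\<close> by blast
  next
    fix x y assume xy: "x \<in> V" "x \<noteq> r" "y \<in> V" "y \<noteq> r" "(x, y) \<in> R"
    show "(f x, f y) \<in> R"
    proof (cases "(f x, f y) \<in> R")
      \<comment> \<open>If \<open>f y\<close> came first, \<open>A (f y)\<close> would be an initial
        segment of \<open>A (f x)\<close> containing \<open>y\<close>, hence also the earlier
        \<open>x\<close>; minimality of \<open>f x\<close> then yields the claim after all.\<close>
      case False
      then have "(f y, f x) \<in> R" using R(4) f(1) xy by blast
      then have "initial_segment R (A (f y)) (A (f x))" using seg f(1) xy by blast
      then have "x \<in> A (f y)" using f(2) xy unfolding initial_segment_def by blast
      then show ?thesis using f(1,3) xy by blast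
    qed
  qed
qed

section \<open>Closer neighbours and geodesics inside initial segments\<close>

lemma bfs_order_closer_neighbour:
  assumes "simple_graph V E" "connected_graph V E" "weakly_modular V E" "bfs_order V E R"
    and "b \<in> V" "c \<in> V" "p \<in> V" "(p, c) \<in> R" "p \<noteq> c"
    and "gdist E V b c = enat i" "gdist E V b p = enat (Suc n)" "Suc i \<le> n"
  obtains y where "y \<in> V" "E p y" "(y, c) \<in> R" "y \<noteq> c" "gdist E V b y = enat n"
proof -
  have wo: "well_order_on V R" using assms(4) by (simp add: bfs_order_def)
  note R = well_order_onD[OF wo]
  have sym: "E x y \<Longrightarrow> E y x" for x y using assms(1) unfolding simple_graph_def by blast
  have dsym: "gdist E V u v = gdist E V v u" for u v by (rule gdist_sym[OF sym])
  have edge: "m \<le> Suc k"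
    if "E u v" "gdist E V b u = enat k" "gdist E V b v = enat m" for u v k m
  proof -
    have "v \<in> V" "E v u" using that(1) assms(1) unfolding simple_graph_def by blast+
    then show ?thesis using gdist_edge_le[of v V E u b k] that dsym[of _ b] by simp
  qed
  obtain r f where r: "r \<in> V" "\<And>x. x \<in> V \<Longrightarrow> (r, x) \<in> R"
    and f: "\<And>x. x \<in> V \<Longrightarrow> x \<noteq> r \<Longrightarrow> f x \<in> V \<and> E x (f x) \<and> (f x, x) \<in> R"
    and fle: "\<And>x w. x \<in> V \<Longrightarrow> x \<noteq> r \<Longrightarrow> E x w \<Longrightarrow> (f x, w) \<in> R"
    and fmono: "\<And>x y. x \<in> V \<Longrightarrow> x \<noteq> r \<Longrightarrow> y \<in> V \<Longrightarrow> y \<noteq> r \<Longrightarrow> (x, y) \<in> R \<Longrightarrow> (f x, f y) \<in> R"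
    using bfs_order_parent[OF assms(1,4)] assms(5) by blast
  \<comment> \<open>If \<open>c\<close> preceded or equalled \<open>y\<close>, then
    \<open>f c\<close> would precede or equal \<open>f y\<close> by monotonicity, and
    \<open>f y\<close> would precede or equal the neighbour \<open>w\<close> of \<open>y\<close>,
    against \<open>w\<close> lying strictly before \<open>f c\<close>.\<close>
  have below: "(y, c) \<in> R \<and> y \<noteq> c"
    if "y \<in> V" "E y w" "(w, f c) \<in> R" "w \<noteq> f c" "c \<in> V" "c \<noteq> r" for y w c
  proof (rule ccontr)
    assume "\<not> ((y, c) \<in> R \<and> y \<noteq> c)"
    then have cy: "(c, y) \<in> R" using R(1,4) that by blast
    then have "y \<noteq> r" using r R(3) that by blast
    then have "(f c, w) \<in> R" using cy fmono fle R(2) that by blast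
    then show False using R(3) that by blast
  qed
  have "wf (R - Id)" using wo by (simp add: well_order_on_def)
  \<comment> \<open>Here \<open>c\<close>, \<open>i\<close> and \<open>n\<close> are general because
    the induction on \<open>p\<close> moves to the pair of parents, while \<open>b\<close> stays
    fixed.\<close>
  then have "\<lbrakk>p \<in> V; c \<in> V; (p, c) \<in> R; p \<noteq> c; gdist E V b c = enat i;
      gdist E V b p = enat (Suc n); Suc i \<le> n\<rbrakk> \<Longrightarrow>
      \<exists>y\<in>V. E p y \<and> (y, c) \<in> R \<and> y \<noteq> c \<and> gdist E V b y = enat n" for p c i n
  proof (induction p arbitrary: c i n rule: wf_induct_rule)
    case (less p)
    have cr: "c \<noteq> r" using less.prems r R(3) by blast
    have fc: "f c \<in> V" "E c (f c)" using f less.prems cr by blast+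
    obtain j where j: "gdist E V b (f c) = enat j"
      using gdist_finite[OF assms(2,5) fc(1)] .
    have ji: "j \<le> Suc i" using edge[OF fc(2)] less.prems j by blast
    show ?case
    proof (cases "(p, f c) \<in> R \<and> p \<noteq> f c")
      case True
      \<comment> \<open>Every neighbour of \<open>p\<close> now precedes \<open>c\<close>, so closeness to \<open>b\<close> is the only requirement.\<close>
      have "gdist E V p b = enat (Suc n)" using less.prems dsym by simp
      then obtain y where "y \<in> V" "E p y" "gdist E V y b = enat n" by (rule gdist_step)
      then show ?thesis using below[of y p c] True less.prems cr sym dsym by metis
    next
      case False
      \<comment> \<open>The root is never after \<open>f c\<close>, so in this case
        \<open>p = r\<close> forces \<open>f c = p\<close>; but \<open>f c\<close> is at distance
        \<open>j \<le> Suc i \<le> n\<close> from \<open>b\<close>, and \<open>p\<close> at distance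
        \<open>Suc n\<close>.\<close>
      have pr: "p \<noteq> r"
      proof
        assume "p = r"
        then have "f c = p" using False r fc by blast
        then show False using j ji less.prems by simp
      qed
      define q where "q = f p"
      have q: "q \<in> V" "E p q" "(q, p) \<in> R" using f less.prems pr unfolding q_def by blast+
      have "p \<noteq> q" using q(2) assms(1) unfolding simple_graph_def by blast
      have qc: "(q, f c) \<in> R" using fmono less.prems pr cr unfolding q_def by blast
      obtain m where m: "gdist E V b q = enat m" using gdist_finite[OF assms(2,5) q(1)] .
      have "m \<le> Suc (Suc n)" "Suc n \<le> Suc m"
        using edge[OF q(2)] edge[OF sym[OF q(2)]] m less.prems by blast+
      then consider "m = n" | "m = Suc n" | "m = Suc (Suc n)" by linarith
      then show ?thesis
      proof cases
        \<comment> \<open>The parent of \<open>p\<close> is itself the required neighbour.\<close>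
        case 1
        have "(q, c) \<in> R" using R(2) q(3) less.prems by blast
        moreover have "q \<noteq> c" using R(3) q(3) less.prems \<open>p \<noteq> q\<close> by blast
        ultimately show ?thesis using 1 m q by blast
      next
        case 2
        \<comment> \<open>Since \<open>j \<le> n\<close>, \<open>f c\<close> is closer to
          \<open>b\<close> than \<open>q\<close>. Thus \<open>q\<close> is strictly before
          \<open>f c\<close>, and \<open>below\<close> applies to the common neighbour of
          \<open>p\<close> and \<open>q\<close> from the triangle condition.\<close>
        then have "q \<noteq> f c" using m j ji less.prems by auto
        obtain y where "y \<in> V" "E p y" "E q y" "gdist E V b y = enat n"
          using weakly_modular_triangle[OF assms(1,3,5) q(2)] less.prems m 2 by force
        then show ?thesis using below[of y q c] qc \<open>q \<noteq> f c\<close> less.prems cr sym by blast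
      next
        case 3
        then have "q \<noteq> f c" using m j ji less.prems by auto
        moreover have "(q, p) \<in> R - Id" using q \<open>p \<noteq> q\<close> by blast
        \<comment> \<open>The gap of 2 survives the passage to parents: \<open>q\<close> is one step
          farther from \<open>b\<close> than \<open>p\<close>, and \<open>f c\<close> at most one
          step farther than \<open>c\<close>.\<close>
        ultimately obtain z where z: "z \<in> V" "E q z" "(z, f c) \<in> R" "z \<noteq> f c"
          "gdist E V b z = enat (Suc n)"
          using less.IH[of q "f c" j "Suc n"] q fc qc j m 3 ji less.prems by auto
        \<comment> \<open>Unlike \<open>z\<close>, the vertex \<open>p\<close> is not strictly
          before \<open>f c\<close> in this case.\<close>
        have "z \<noteq> p" using False z by blast
        have n: "n \<ge> 1" using less.prems by simp
        \<comment> \<open>Both \<open>p\<close> and \<open>z\<close> are neighbours of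
          \<open>q\<close> one step closer to \<open>b\<close>: if adjacent they fall under the
          triangle condition, otherwise under the quadrangle condition with far vertex
          \<open>q\<close>.\<close>
        obtain y where "y \<in> V" "E p y" "E z y" "gdist E V b y = enat n"
        proof (cases "E p z")
          case True
          then show thesis
            using weakly_modular_triangle[OF assms(1,3,5) True] less.prems(6) z(5) n that by blast
        next
          case False
          then show thesis
            using weakly_modular_quadrangle[OF assms(1,3,5) q(2) sym[OF z(2)] _ False]
              \<open>z \<noteq> p\<close> less.prems(6) z(5) m 3 n that by blast
        qed
        then show ?thesis using below[of y z c] z less.prems cr sym by blast
      qed
    qed
  qed
  from this[OF assms(7,6,8-12)] that show thesis by blast
qed

theorem theorem9p11:
  fixes V :: "'a set" and E :: "'a \<Rightarrow> 'a \<Rightarrow> bool" and R :: "('a \<times> 'a) set"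
  assumes "simple_graph V E" and "connected_graph V E" and "weakly_modular V E"
    and "bfs_order V E R"
  shows "distance_preserving V E R"
proof -
  have wo: "well_order_on V R" using assms(4) by (simp add: bfs_order_def)
  note R = well_order_onD[OF wo]
  have sym: "E x y \<Longrightarrow> E y x" for x y using assms(1) unfolding simple_graph_def by blast
  have dsym: "gdist E S u v = gdist E S v u" for S u v by (rule gdist_sym[OF sym])
  have "gdist E S a b = gdist E V a b"
    if v: "v \<in> V" and S: "S = {u\<in>V. (u, v) \<in> R}" and a: "a \<in> S" and b: "b \<in> S" for v S a b
  proof (rule antisym)
    have SV: "S \<subseteq> V" using S by blast
    show "gdist E V a b \<le> gdist E S a b" by (rule gdist_mono[OF SV])
    \<comment> \<open>The walk starts at the earlier endpoint and keeps all its vertices at or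
      before \<open>b\<close>, hence in \<open>S\<close>.\<close>
    have up: "gdist E S a b \<le> enat n"
      if "gdist E V a b = enat n" "a \<in> S" "b \<in> S" "(a, b) \<in> R" for n a b
      using that
    proof (induction n arbitrary: a)
      case 0
      then have "a = b" using gdist_eq_0D[of E V a b] by (simp add: zero_enat_def)
      then show ?case using gdist_self[of b S E] 0 by simp
    next
      case (Suc n)
      have "\<exists>y\<in>S. E a y \<and> (y, b) \<in> R \<and> gdist E V y b = enat n"
      \<comment> \<open>The closer-neighbour lemma with \<open>c = b\<close> and
        \<open>i = 0\<close> needs distance at least 2, so adjacent endpoints are treated
        separately.\<close>
      proof (cases "n = 0")
        case True
        obtain y where "y \<in> V" "E a y" "gdist E V y b = enat n"
          using gdist_step[OF Suc.prems(1)] .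
        moreover from this have "y = b"
          using True gdist_eq_0D[of E V y b] by (simp add: zero_enat_def)
        ultimately show ?thesis using Suc.prems R(1) SV by blast
      next
        case False
        have V: "a \<in> V" "b \<in> V" using Suc.prems SV by blast+
        have 0: "gdist E V b b = enat 0" using gdist_self[OF V(2), of E] by (simp add: zero_enat_def)
        then have "a \<noteq> b" using Suc.prems by auto
        obtain y where "y \<in> V" "E a y" "(y, b) \<in> R" "gdist E V b y = enat n"
          using bfs_order_closer_neighbour[OF assms V(2,2,1) Suc.prems(4) \<open>a \<noteq> b\<close> 0, of n]
            Suc.prems(1) dsym[of V a b] False by auto
        then show ?thesis using S Suc.prems(3) R(2) dsym[of V b y] by auto
      qed
      then show ?case using Suc.IH Suc.prems gdist_edge_le[of a S E] by blast
    qed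
    obtain n where n: "gdist E V a b = enat n"
      using gdist_finite[OF assms(2)] a b SV by blast
    \<comment> \<open>By totality one endpoint precedes the other; symmetry of both distances lets
      \<open>up\<close> run from that one.\<close>
    show "gdist E S a b \<le> gdist E V a b"
      using up[of a b n] up[of b a n] n dsym[of V a b] dsym[of S a b] a b SV R(4) by auto
  qed
  then show ?thesis unfolding distance_preserving_def Let_def using wo by blast
qed

end
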